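(* Let $K\in End^*_{\mathcal A}(U)$ and let $\{\Theta_m\}_{m\in\mathcal M}$, $\Theta_m\in End^*_{\mathcal A}(U,V_m)$, be a $c$-$g$-orthonormal basis for $U$ with respect to $\{V_m\}_{m\in\mathcal M}$. Suppose that $\{\Lambda_m\}_{m\in\mathcal M}$, $\Lambda_m\in End^*_{\mathcal A}(U,V_m)$, is a $c$-$K$-$g$-frame for $U$ and $\{\Gamma_m\}_{m\in\mathcal M}$, $\Gamma_m\in End^*_{\mathcal A}(U,V_m)$, is a $c$-$g$-Bessel system for $U$, both with respect to $\{V_m\}_{m\in\mathcal M}$, with synthesis operators $T$ and $R$, respectively. Then $\{\Gamma_m\}_{m\in\mathcal M}$ is a dual $c$-$K$-$g$-Bessel system of $\{\Lambda_m\}_{m\in\mathcal M}$ if and only if $K=TR^*$.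
   Context: $\mathcal A$ is a complex $C^*$-algebra; $U$ and $V$ are (left) Hilbert $\mathcal A$-modules, with $\mathcal A$-valued inner products that are $\mathcal A$-linear in the first variable and norm $\|f\|=\|\langle f,f\rangle\|^{1/2}$; $(\mathcal M,\mu)$ is a measure space with positive measure; $\{V_m\}_{m\in\mathcal M}$ is a family of closed submodules of $V$. $End^*_{\mathcal A}(X,Y)$ is the set of adjointable $\mathcal A$-linear maps $X\to Y$, and $End^*_{\mathcal A}(U)=End^*_{\mathcal A}(U,U)$. Integrals of Banach-space-valued functions are weak (Pettis) integrals, and an (in)equality involving an integral includes the assertion that the integral exists. $\bigoplus_{m\in\mathcal M}V_m$ is the space of strongly measurable families $\{g_m\}_{m\in\mathcal M}$ (modulo a.e. equality) with $g_m\in V_m$ and $\left\|\int_{\mathcal M}|g_m|^2d\mu(m)\right\|<\infty$, where $|g_m|^2=\langle g_m,g_m\rangle$, with $\mathcal A$-valued inner product $\langle f,g\rangle=\int_{\mathcal M}\langle f_m,g_m\rangle d\mu(m)$; it is a standing assumption that this is a Hilbert $\mathcal A$-module. For $K\in End^*_{\mathcal A}(U)$, a family $\{\Lambda_m\}_{m\in\mathcal M}$ with $\Lambda_m\in End^*_{\mathcal A}(U,V_m)$ is a $c$-$K$-$g$-frame for $U$ with respect to $\{V_m\}$ if for every $f\in U$ the map $m\mapsto\Lambda_mf$ is strongly measurable and there exist constants $A,B>0$ with $A\langle K^*f,K^*f\rangle\le\int_{\mathcal M}\langle\Lambda_mf,\Lambda_mf\rangle d\mu(m)\le B\langle f,f\rangle$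 for all $f\in U$. It is a $c$-$g$-Bessel system if the measurability condition and the right-hand inequality hold for some $B>0$. A family $\{\Theta_m\}_{m\in\mathcal M}$, $\Theta_m\in End^*_{\mathcal A}(U,V_m)$, is a $c$-$g$-orthonormal basis for $U$ with respect to $\{V_m\}$ if (i) for all $f\in U$, $m\mapsto\Theta_mf$ is strongly measurable; (ii) for every $\{g_m\}_{m\in\mathcal M}\in\bigoplus_{m\in\mathcal M}V_m$, for almost all $n\in\mathcal M$, $\int_{\mathcal M}\langle\Theta_m^*g_m,\Theta_n^*h_n\rangle d\mu(m)=\langle g_n,h_n\rangle$ for all $h_n\in V_n$; (iii) $\int_{\mathcal M}\langle\Theta_mf,\Theta_mf\rangle d\mu(m)=\langle f,f\rangle$ for all $f\in U$. The synthesis operator of a $c$-$g$-Bessel system $\{\Lambda_m\}$ is the bounded adjointable operator $T:\bigoplus_{m\in\mathcal M}V_m\to U$ determined by $\langle Tf,g\rangle=\int_{\mathcal M}\langle\Lambda_m^*f_m,g\rangle d\mu(m)$ for $f=\{f_m\}\in\bigoplus V_m$, $g\in U$; its adjoint is $T^*g=\{\Lambda_mg\}_{m\in\mathcal M}$. Given a $c$-$K$-$g$-frame $\{\Lambda_m\}$ for $U$ with respect to $\{V_m\}$, a $c$-$g$-Bessel system $\{\Gamma_m\}$, $\Gamma_m\in End^*_{\mathcal A}(U,V_m)$, is a dual $c$-$K$-$g$-Bessel system of $\{\Lambda_m\}$ if $\langle Kf,g\rangle=\int_{\mathcal M}\langle\Lambda_m^*\Gamma_mf,g\rangle d\mu(m)$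 for all $f,g\in U$. *)

theory Defs
  imports "HOL-Analysis.Analysis" "HOL-Algebra.Module"
begin

section \<open>\<open>C\<^sup>*\<close>-algebras\<close>

text \<open>Complex, not necessarily unital.\<close>

class cstar_algebra = real_normed_algebra + banach +
  fixes scaleC :: "complex \<Rightarrow> 'a \<Rightarrow> 'a"  (infixr \<open>*\<^sub>C\<close> 75)
    and star :: "'a \<Rightarrow> 'a"
  assumes scaleC_add_right: "c *\<^sub>C (x + y) = c *\<^sub>C x + c *\<^sub>C y"
    and scaleC_add_left: "(c + d) *\<^sub>C x = c *\<^sub>C x + d *\<^sub>C x"
    and scaleC_scaleC: "c *\<^sub>C d *\<^sub>C x = (c * d) *\<^sub>C x"
    and scaleC_of_real: "complex_of_real r *\<^sub>C x = r *\<^sub>R x"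
    and norm_scaleC: "norm (c *\<^sub>C x) = cmod c * norm x"
    and mult_scaleC_left: "(c *\<^sub>C x) * y = c *\<^sub>C (x * y)"
    and mult_scaleC_right: "x * (c *\<^sub>C y) = c *\<^sub>C (x * y)"
    and star_star: "star (star x) = x"
    and star_add: "star (x + y) = star x + star y"
    and star_scaleC: "star (c *\<^sub>C x) = cnj c *\<^sub>C star x"
    and star_mult: "star (x * y) = star y * star x"
    and norm_star_mult_self: "norm (star x * x) = (norm x)\<^sup>2"

definition positive :: "'a::cstar_algebra \<Rightarrow> bool"
  where "positive a \<longleftrightarrow> (\<exists>b. a = star b * b)"

definition cstar_le :: "'a::cstar_algebra \<Rightarrow> 'a \<Rightarrow> bool"  (infix \<open>\<preceq>\<close> 50)
  where "a \<preceq> b \<longleftrightarrow> positive (b - a)"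


section \<open>Hilbert modules\<close>

text \<open>
  Left Hilbert modules with an explicit carrier over the algebra given by the type \<open>'a\<close>. The record
  extends HOL-Algebra's module record, whose ring multiplication and unit play no role here.
\<close>

record ('a, 'x) hmodule = "('a, 'x) module" +
  cscale :: "complex \<Rightarrow> 'x \<Rightarrow> 'x"
  ip :: "'x \<Rightarrow> 'x \<Rightarrow> 'a"

definition hnorm :: "('a::cstar_algebra, 'x, 'z) hmodule_scheme \<Rightarrow> 'x \<Rightarrow> real"
  where "hnorm X x = sqrt (norm (ip X x x))"

definition hdist :: "('a::cstar_algebra, 'x, 'z) hmodule_scheme \<Rightarrow> 'x \<Rightarrow> 'x \<Rightarrow> real"
  where "hdist X x y = hnorm X (x \<ominus>\<^bsub>X\<^esub> y)"

locale hilbert_module = abelian_group X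
  for X :: "('a::cstar_algebra, 'x, 'z) hmodule_scheme" (structure) +
  assumes cscale_closed: "x \<in> carrier X \<Longrightarrow> cscale X c x \<in> carrier X"
    and cscale_add_right: "\<lbrakk>x \<in> carrier X; y \<in> carrier X\<rbrakk>
          \<Longrightarrow> cscale X c (x \<oplus> y) = cscale X c x \<oplus> cscale X c y"
    and cscale_add_left: "x \<in> carrier X \<Longrightarrow> cscale X (c + d) x = cscale X c x \<oplus> cscale X d x"
    and cscale_cscale: "x \<in> carrier X \<Longrightarrow> cscale X c (cscale X d x) = cscale X (c * d) x"
    and cscale_one: "x \<in> carrier X \<Longrightarrow> cscale X 1 x = x"
    and act_closed: "x \<in> carrier X \<Longrightarrow> a \<odot> x \<in> carrier X"
    and act_add_right: "\<lbrakk>x \<in> carrier X; y \<in> carrier X\<rbrakk> \<Longrightarrow> a \<odot> (x \<oplus> y) = a \<odot> x \<oplus> a \<odot> y"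
    and act_add_left: "x \<in> carrier X \<Longrightarrow> (a + b) \<odot> x = a \<odot> x \<oplus> b \<odot> x"
    and act_act: "x \<in> carrier X \<Longrightarrow> a \<odot> (b \<odot> x) = (a * b) \<odot> x"
    and act_scaleC: "x \<in> carrier X \<Longrightarrow> (c *\<^sub>C a) \<odot> x = cscale X c (a \<odot> x)"
    and act_cscale: "x \<in> carrier X \<Longrightarrow> a \<odot> cscale X c x = cscale X c (a \<odot> x)"
    and ip_add: "\<lbrakk>x \<in> carrier X; y \<in> carrier X; z \<in> carrier X\<rbrakk>
          \<Longrightarrow> ip X (x \<oplus> y) z = ip X x z + ip X y z"
    and ip_cscale: "\<lbrakk>x \<in> carrier X; y \<in> carrier X\<rbrakk> \<Longrightarrow> ip X (cscale X c x) y = c *\<^sub>C ip X x y"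
    and ip_act: "\<lbrakk>x \<in> carrier X; y \<in> carrier X\<rbrakk> \<Longrightarrow> ip X (a \<odot> x) y = a * ip X x y"
    and ip_star: "\<lbrakk>x \<in> carrier X; y \<in> carrier X\<rbrakk> \<Longrightarrow> star (ip X x y) = ip X y x"
    and ip_positive: "x \<in> carrier X \<Longrightarrow> positive (ip X x x)"
    and ip_definite: "\<lbrakk>x \<in> carrier X; ip X x x = 0\<rbrakk> \<Longrightarrow> x = \<zero>"
    and complete: "Metric_space.mcomplete (carrier X) (hdist X)"

definition closed_submodule :: "('a::cstar_algebra, 'x, 'z) hmodule_scheme \<Rightarrow> 'x set \<Rightarrow> bool"
  where "closed_submodule X W \<longleftrightarrow>
    W \<subseteq> carrier X \<and> \<zero>\<^bsub>X\<^esub> \<in> W \<and>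
    (\<forall>x\<in>W. \<forall>y\<in>W. x \<oplus>\<^bsub>X\<^esub> y \<in> W) \<and>
    (\<forall>c. \<forall>x\<in>W. cscale X c x \<in> W) \<and>
    (\<forall>a. \<forall>x\<in>W. a \<odot>\<^bsub>X\<^esub> x \<in> W) \<and>
    closedin (Metric_space.mtopology (carrier X) (hdist X)) W"

abbreviation restrict_module ::
    "('a::cstar_algebra, 'x, 'z) hmodule_scheme \<Rightarrow> 'x set \<Rightarrow> ('a, 'x, 'z) hmodule_scheme"
    (infixl \<open>\<restriction>\<close> 90)
  where "X \<restriction> W \<equiv> X\<lparr>carrier := W\<rparr>"

text \<open>\<open>End\<^sup>*(X, Y)\<close>. Boundedness is automatic for adjointable maps.\<close>

definition End_star :: "('a::cstar_algebra, 'x, 'z) hmodule_scheme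
    \<Rightarrow> ('a, 'y, 'w) hmodule_scheme \<Rightarrow> ('x \<Rightarrow> 'y) set"
  where "End_star X Y = {T \<in> carrier X \<rightarrow> carrier Y.
    (\<forall>x\<in>carrier X. \<forall>y\<in>carrier X. T (x \<oplus>\<^bsub>X\<^esub> y) = T x \<oplus>\<^bsub>Y\<^esub> T y) \<and>
    (\<forall>c. \<forall>x\<in>carrier X. T (cscale X c x) = cscale Y c (T x)) \<and>
    (\<forall>a. \<forall>x\<in>carrier X. T (a \<odot>\<^bsub>X\<^esub> x) = a \<odot>\<^bsub>Y\<^esub> T x) \<and>
    (\<exists>S \<in> carrier Y \<rightarrow> carrier X. \<forall>x\<in>carrier X. \<forall>y\<in>carrier Y. ip Y (T x) y = ip X x (S y))}"

definition hadj :: "('a::cstar_algebra, 'x, 'z) hmodule_scheme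
    \<Rightarrow> ('a, 'y, 'w) hmodule_scheme \<Rightarrow> ('x \<Rightarrow> 'y) \<Rightarrow> 'y \<Rightarrow> 'x"
  where "hadj X Y T y = (THE x. x \<in> carrier X \<and> (\<forall>z\<in>carrier X. ip Y (T z) y = ip X z x))"


section \<open>Measurability and integration\<close>

text \<open>
  Strong measurability: almost everywhere a norm limit of simple functions. It is invariant under
  a.e. modification, so the scalar functions in the weak integral are in general only measurable
  with respect to the completion of the measure.
\<close>

definition strongly_measurable ::
    "'m measure \<Rightarrow> ('a::cstar_algebra, 'x, 'z) hmodule_scheme \<Rightarrow> ('m \<Rightarrow> 'x) \<Rightarrow> bool"
  where "strongly_measurable M X g \<longleftrightarrow> (\<exists>s :: nat \<Rightarrow> 'm \<Rightarrow> 'x.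
    (\<forall>i. simple_function M (s i) \<and> s i \<in> space M \<rightarrow> carrier X) \<and>
    (AE m in M. (\<lambda>i. hdist X (s i m) (g m)) \<longlonglongrightarrow> 0))"

definition bounded_functional :: "('a::cstar_algebra \<Rightarrow> complex) \<Rightarrow> bool"
  where "bounded_functional \<phi> \<longleftrightarrow> bounded_linear \<phi> \<and> (\<forall>c x. \<phi> (c *\<^sub>C x) = c * \<phi> x)"

definition has_weak_integral :: "'m measure \<Rightarrow> ('m \<Rightarrow> 'a::cstar_algebra) \<Rightarrow> 'a \<Rightarrow> bool"
  where "has_weak_integral M F x \<longleftrightarrow> (\<forall>\<phi>. bounded_functional \<phi> \<longrightarrow>
    has_bochner_integral (completion M) (\<lambda>m. \<phi> (F m)) (\<phi> x))"

definition weak_integral :: "'m measure \<Rightarrow> ('m \<Rightarrow> 'a::cstar_algebra) \<Rightarrow> 'a"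
  where "weak_integral M F = (THE x. has_weak_integral M F x)"


section \<open>The direct sum of a family of submodules\<close>

definition sum_families :: "'m measure \<Rightarrow> ('a::cstar_algebra, 'v, 'z) hmodule_scheme
    \<Rightarrow> ('m \<Rightarrow> 'v set) \<Rightarrow> ('m \<Rightarrow> 'v) set"
  where "sum_families M V W = {g. (\<forall>m\<in>space M. g m \<in> W m) \<and> strongly_measurable M V g \<and>
    (\<exists>x. has_weak_integral M (\<lambda>m. ip V (g m) (g m)) x)}"

text \<open>The a.e.-equality class of a family.\<close>

definition family_class :: "'m measure \<Rightarrow> ('a::cstar_algebra, 'v, 'z) hmodule_scheme
    \<Rightarrow> ('m \<Rightarrow> 'v set) \<Rightarrow> ('m \<Rightarrow> 'v) \<Rightarrow> ('m \<Rightarrow> 'v) set"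
  where "family_class M V W g = {h \<in> sum_families M V W. AE m in M. h m = g m}"

abbreviation (input) some_rep :: "'b set \<Rightarrow> 'b"
  where "some_rep C \<equiv> (SOME g. g \<in> C)"

text \<open>
  The operations are computed on representatives. Asserting \<^prop>\<open>hilbert_module (direct_sum M V W)\<close>
  includes that the square-integrable families are closed under the pointwise operations, hence by
  polarization that all the weak integrals defining the inner product exist. The first two
  fields are the unused ones of the module record.
\<close>

definition direct_sum :: "'m measure \<Rightarrow> ('a::cstar_algebra, 'v, 'z) hmodule_scheme
    \<Rightarrow> ('m \<Rightarrow> 'v set) \<Rightarrow> ('a, ('m \<Rightarrow> 'v) set) hmodule"
  where "direct_sum M V W =
    \<lparr>carrier = family_class M V W ` sum_families M V W,
     monoid.mult = undefined,
     one = undefined,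
     zero = family_class M V W (\<lambda>m. \<zero>\<^bsub>V\<^esub>),
     add = (\<lambda>F G. family_class M V W (\<lambda>m. some_rep F m \<oplus>\<^bsub>V\<^esub> some_rep G m)),
     smult = (\<lambda>a F. family_class M V W (\<lambda>m. a \<odot>\<^bsub>V\<^esub> some_rep F m)),
     cscale = (\<lambda>c F. family_class M V W (\<lambda>m. cscale V c (some_rep F m))),
     ip = (\<lambda>F G. weak_integral M (\<lambda>m. ip V (some_rep F m) (some_rep G m)))\<rparr>"


section \<open>Frames, Bessel systems and orthonormal bases\<close>

definition cg_family :: "'m measure \<Rightarrow> ('a::cstar_algebra, 'u, 'y) hmodule_scheme
    \<Rightarrow> ('a, 'v, 'z) hmodule_scheme \<Rightarrow> ('m \<Rightarrow> 'v set) \<Rightarrow> ('m \<Rightarrow> 'u \<Rightarrow> 'v) \<Rightarrow> bool"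
  where "cg_family M U V W \<Lambda> \<longleftrightarrow>
    (\<forall>m\<in>space M. \<Lambda> m \<in> End_star U (V \<restriction> W m)) \<and>
    (\<forall>f\<in>carrier U. strongly_measurable M V (\<lambda>m. \<Lambda> m f))"

definition cKg_frame :: "'m measure \<Rightarrow> ('a::cstar_algebra, 'u, 'y) hmodule_scheme
    \<Rightarrow> ('a, 'v, 'z) hmodule_scheme \<Rightarrow> ('m \<Rightarrow> 'v set) \<Rightarrow> ('u \<Rightarrow> 'u) \<Rightarrow> ('m \<Rightarrow> 'u \<Rightarrow> 'v) \<Rightarrow> bool"
  where "cKg_frame M U V W K \<Lambda> \<longleftrightarrow> cg_family M U V W \<Lambda> \<and>
    (\<exists>A>0. \<exists>B>0. \<forall>f\<in>carrier U. \<exists>x. has_weak_integral M (\<lambda>m. ip V (\<Lambda> m f) (\<Lambda> m f)) x \<and>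
      A *\<^sub>R ip U (hadj U U K f) (hadj U U K f) \<preceq> x \<and> x \<preceq> B *\<^sub>R ip U f f)"

definition cg_bessel :: "'m measure \<Rightarrow> ('a::cstar_algebra, 'u, 'y) hmodule_scheme
    \<Rightarrow> ('a, 'v, 'z) hmodule_scheme \<Rightarrow> ('m \<Rightarrow> 'v set) \<Rightarrow> ('m \<Rightarrow> 'u \<Rightarrow> 'v) \<Rightarrow> bool"
  where "cg_bessel M U V W \<Lambda> \<longleftrightarrow> cg_family M U V W \<Lambda> \<and>
    (\<exists>B>0. \<forall>f\<in>carrier U. \<exists>x. has_weak_integral M (\<lambda>m. ip V (\<Lambda> m f) (\<Lambda> m f)) x \<and>
      x \<preceq> B *\<^sub>R ip U f f)"

definition cg_orthonormal_basis :: "'m measure \<Rightarrow> ('a::cstar_algebra, 'u, 'y) hmodule_scheme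
    \<Rightarrow> ('a, 'v, 'z) hmodule_scheme \<Rightarrow> ('m \<Rightarrow> 'v set) \<Rightarrow> ('m \<Rightarrow> 'u \<Rightarrow> 'v) \<Rightarrow> bool"
  where "cg_orthonormal_basis M U V W \<Theta> \<longleftrightarrow> cg_family M U V W \<Theta> \<and>
    (\<forall>g\<in>sum_families M V W. AE n in M. \<forall>h\<in>W n.
      has_weak_integral M
        (\<lambda>m. ip U (hadj U (V \<restriction> W m) (\<Theta> m) (g m)) (hadj U (V \<restriction> W n) (\<Theta> n) h))
        (ip V (g n) h)) \<and>
    (\<forall>f\<in>carrier U. has_weak_integral M (\<lambda>m. ip V (\<Theta> m f) (\<Theta> m f)) (ip U f f))"

text \<open>\<open>T\<close> is the synthesis operator of \<open>\<Lambda>\<close>; this determines \<open>T\<close> on the direct sum.\<close>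

definition synthesis_operator :: "'m measure \<Rightarrow> ('a::cstar_algebra, 'u, 'y) hmodule_scheme
    \<Rightarrow> ('a, 'v, 'z) hmodule_scheme \<Rightarrow> ('m \<Rightarrow> 'v set) \<Rightarrow> ('m \<Rightarrow> 'u \<Rightarrow> 'v)
    \<Rightarrow> (('m \<Rightarrow> 'v) set \<Rightarrow> 'u) \<Rightarrow> bool"
  where "synthesis_operator M U V W \<Lambda> T \<longleftrightarrow> T \<in> End_star (direct_sum M V W) U \<and>
    (\<forall>f\<in>sum_families M V W. \<forall>g\<in>carrier U.
      has_weak_integral M (\<lambda>m. ip U (hadj U (V \<restriction> W m) (\<Lambda> m) (f m)) g)
        (ip U (T (family_class M V W f)) g))"

definition dual_cKg_bessel :: "'m measure \<Rightarrow> ('a::cstar_algebra, 'u, 'y) hmodule_scheme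
    \<Rightarrow> ('a, 'v, 'z) hmodule_scheme \<Rightarrow> ('m \<Rightarrow> 'v set) \<Rightarrow> ('u \<Rightarrow> 'u)
    \<Rightarrow> ('m \<Rightarrow> 'u \<Rightarrow> 'v) \<Rightarrow> ('m \<Rightarrow> 'u \<Rightarrow> 'v) \<Rightarrow> bool"
  where "dual_cKg_bessel M U V W K \<Lambda> \<Gamma> \<longleftrightarrow> cg_bessel M U V W \<Gamma> \<and>
    (\<forall>f\<in>carrier U. \<forall>g\<in>carrier U.
      has_weak_integral M (\<lambda>m. ip U (hadj U (V \<restriction> W m) (\<Lambda> m) (\<Gamma> m f)) g) (ip U (K f) g))"

end

theory Submission
  imports Defs
begin

text \<open>
  The adjoint \<open>R\<^sup>*\<close> of the synthesis operator of \<open>\<Gamma>\<close> is the analysis map \<open>f \<mapsto> {\<Gamma>\<^sub>m f}\<close>. Hence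
  \<open>\<langle>T R\<^sup>* f, g\<rangle>\<close> is the weak integral of \<open>\<langle>\<Lambda>\<^sub>m\<^sup>* \<Gamma>\<^sub>m f, g\<rangle>\<close>, and the equivalence says that this integral
  determines \<open>T R\<^sup>* f\<close>. Uniqueness of weak integrals needs enough bounded functionals, that is,
  the Hahn--Banach theorem: a sublinear functional that is minimal for the pointwise order is linear.
\<close>

section \<open>Sublinear functionals and the Hahn-Banach theorem\<close>

definition sublinear :: "('a::real_vector \<Rightarrow> real) \<Rightarrow> bool"
  where "sublinear p \<longleftrightarrow> (\<forall>x y. p (x + y) \<le> p x + p y) \<and> (\<forall>t\<ge>0. \<forall>x. p (t *\<^sub>R x) \<le> t * p x)"

lemma sublinear_add: "sublinear p \<Longrightarrow> p (x + y) \<le> p x + p y"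
  by (simp add: sublinear_def)

lemma sublinear_zero:
  assumes "sublinear p" shows "p 0 = 0"
proof -
  have "p (0 *\<^sub>R 0) \<le> 0 * p 0" using assms unfolding sublinear_def by blast
  moreover have "p (0 + 0) \<le> p 0 + p 0" using assms unfolding sublinear_def by blast
  ultimately show ?thesis by simp
qed

text \<open>The reverse inequality is the defining one for \<open>inverse t\<close> at
  \<open>t *\<^sub>R x\<close>. Hence homogeneity has to be checked only as an inequality, the form
  that passes easily to infima.\<close>

lemma sublinear_scaleR:
  assumes "sublinear p" "t \<ge> 0" shows "p (t *\<^sub>R x) = t * p x"
proof (cases "t = 0")
  case True
  then show ?thesis by (simp add: sublinear_zero assms)
next
  case False
  then have t: "t > 0" using assms by simp
  have "p (inverse t *\<^sub>R (t *\<^sub>R x)) \<le> inverse t * p (t *\<^sub>R x)"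
    using assms t unfolding sublinear_def by (meson inverse_nonnegative_iff_nonnegative)
  then have "t * p x \<le> p (t *\<^sub>R x)"
    using t by (simp add: field_simps)
  moreover have "p (t *\<^sub>R x) \<le> t * p x" using assms unfolding sublinear_def by blast
  ultimately show ?thesis by simp
qed

lemma sublinear_ge:
  assumes "sublinear p" shows "- p (- x) \<le> p x"
  using sublinear_add[OF assms, of x "-x"] sublinear_zero[OF assms] by simp

text \<open>The common majorant \<open>p\<close> keeps the infima finite, since
  \<open>- p (- x) \<le> - q (- x) \<le> q x\<close>. Comparability gives subadditivity: of two
  members of \<open>C\<close>, the smaller one bounds the infimum at \<open>x + y\<close> by the sum
  of their values at \<open>x\<close> and \<open>y\<close>.\<close>

lemma sublinear_INF_chain:
  assumes "C \<noteq> {}" and sub: "\<And>q. q \<in> C \<Longrightarrow> sublinear q"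
    and bound: "\<And>q x. q \<in> C \<Longrightarrow> q x \<le> p x"
    and chain: "\<And>q r. \<lbrakk>q \<in> C; r \<in> C\<rbrakk> \<Longrightarrow> q \<le> r \<or> r \<le> q"
  shows "sublinear (\<lambda>x. INF q\<in>C. q x)"
    and "\<And>q x. q \<in> C \<Longrightarrow> (INF q\<in>C. q x) \<le> q x"
proof -
  have bdd: "bdd_below ((\<lambda>q. q x) ` C)" for x
  proof (rule bdd_belowI2)
    fix q assume "q \<in> C"
    then show "- p (- x) \<le> q x"
      using sublinear_ge[OF sub, of q x] bound[of q "- x"] by linarith
  qed
  show low: "(INF q\<in>C. q x) \<le> q x" if "q \<in> C" for q x
    using cINF_lower[OF bdd that] .
  show "sublinear (\<lambda>x. INF q\<in>C. q x)"
    unfolding sublinear_def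
  proof (intro conjI allI impI)
    fix x y
    have *: "(INF q\<in>C. q (x + y)) \<le> q x + r y" if q: "q \<in> C" and r: "r \<in> C" for q r
      using chain[OF q r]
    proof
      assume "q \<le> r"
      then show ?thesis using low[OF q, of "x + y"] sublinear_add[OF sub[OF q], of x y]
        by (smt (verit) le_funD)
    next
      assume "r \<le> q"
      then show ?thesis using low[OF r, of "x + y"] sublinear_add[OF sub[OF r], of x y]
        by (smt (verit) le_funD)
    qed
    \<comment> \<open>The two infima are taken one after the other: over \<open>q\<close> with
      \<open>r\<close> fixed, then over \<open>r\<close>.\<close>
    have "(INF q\<in>C. q (x + y)) - r y \<le> (INF q\<in>C. q x)" if "r \<in> C" for r
      using *[OF _ that] by (intro cINF_greatest \<open>C \<noteq> {}\<close>) (simp add: diff_le_eq)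
    then have "(INF q\<in>C. q (x + y)) - (INF q\<in>C. q x) \<le> (INF q\<in>C. q y)"
      by (intro cINF_greatest \<open>C \<noteq> {}\<close>) (simp add: algebra_simps)
    then show "(INF q\<in>C. q (x + y)) \<le> (INF q\<in>C. q x) + (INF q\<in>C. q y)" by simp
  next
    fix t :: real and x
    assume t: "t \<ge> 0"
    obtain r where r: "r \<in> C" using \<open>C \<noteq> {}\<close> by blast
    show "(INF q\<in>C. q (t *\<^sub>R x)) \<le> t * (INF q\<in>C. q x)"
    proof (cases "t = 0")
      case True
      then show ?thesis using low[OF r, of 0] sublinear_zero[OF sub[OF r]] by simp
    next
      case False
      have "(INF q\<in>C. q (t *\<^sub>R x)) / t \<le> (INF q\<in>C. q x)"
      proof (intro cINF_greatest \<open>C \<noteq> {}\<close>)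
        fix q assume q: "q \<in> C"
        show "(INF q\<in>C. q (t *\<^sub>R x)) / t \<le> q x"
          using low[OF q, of "t *\<^sub>R x"] sublinear_scaleR[OF sub[OF q] t, of x] t False
          by (simp add: field_simps)
      qed
      then show ?thesis using t False by (simp add: field_simps)
    qed
  qed
qed

text \<open>The witness is the infimum over \<open>t \<ge> 0\<close> of
  \<open>q (x + t *\<^sub>R y) - t * q y\<close>. The value \<open>t = 0\<close> gives
  \<open>r \<le> q\<close>, and \<open>t = 1\<close> at \<open>- y\<close> gives the last bound. A
  minimal \<open>q\<close> must coincide with \<open>r\<close>, which makes it odd.\<close>

lemma sublinear_lower:
  fixes y :: "'a::real_vector"
  assumes q: "sublinear q"
  shows "\<exists>r. sublinear r \<and> r \<le> q \<and> r (- y) \<le> - q y"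
proof -
  define F where "F x t = q (x + t *\<^sub>R y) - t * q y" for x t
  define r where "r x = (INF t\<in>{0..}. F x t)" for x
  have ne: "{0::real..} \<noteq> {}" by auto
  have bdd: "bdd_below (F x ` {0..})" for x
  proof (rule bdd_belowI2)
    fix t :: real assume "t \<in> {0..}"
    then show "- q (- x) \<le> F x t"
      using sublinear_add[OF q, of "x + t *\<^sub>R y" "- x"] sublinear_scaleR[OF q, of t y]
      by (simp add: F_def)
  qed
  have low: "r x \<le> F x t" if "t \<ge> 0" for x t
    unfolding r_def using cINF_lower[OF bdd] that by auto
  have le: "r x \<le> q x" for x
    using low[of 0 x] by (simp add: F_def)
  have neg: "r (- y) \<le> - q y"
    using low[of 1 "- y"] sublinear_zero[OF q] by (simp add: F_def)
  have "sublinear r"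
    unfolding sublinear_def
  proof (intro conjI allI impI)
    fix x z
    have *: "r (x + z) \<le> F x t + F z s" if "t \<ge> 0" "s \<ge> 0" for t s
    proof -
      have "F (x + z) (t + s) \<le> F x t + F z s"
        using sublinear_add[OF q, of "x + t *\<^sub>R y" "z + s *\<^sub>R y"]
        by (simp add: F_def algebra_simps)
      then show ?thesis using low[of "t + s" "x + z"] that by linarith
    qed
    have "r (x + z) - F z s \<le> r x" if "s \<ge> 0" for s
      unfolding r_def[of x] using *[OF _ that]
      by (intro cINF_greatest ne) (simp add: diff_le_eq)
    then have "r (x + z) - r x \<le> r z"
      unfolding r_def[of z] by (intro cINF_greatest ne) (simp add: algebra_simps)
    then show "r (x + z) \<le> r x + r z" by simp
  next
    fix s :: real and x
    assume s: "s \<ge> 0"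
    show "r (s *\<^sub>R x) \<le> s * r x"
    proof (cases "s = 0")
      case True
      then show ?thesis using le[of 0] sublinear_zero[OF q] by simp
    next
      case False
      have "r (s *\<^sub>R x) / s \<le> r x"
        unfolding r_def[of x]
      proof (intro cINF_greatest ne)
        fix t :: real assume t: "t \<in> {0..}"
        \<comment> \<open>Scaling the point by \<open>s\<close> is matched by scaling the parameter
          \<open>t\<close> by \<open>s\<close>.\<close>
        have "F (s *\<^sub>R x) (s * t) = s * F x t"
          using sublinear_scaleR[OF q s, of "x + t *\<^sub>R y"]
          by (simp add: F_def algebra_simps)
        then show "r (s *\<^sub>R x) / s \<le> F x t"
          using low[of "s * t" "s *\<^sub>R x"] s False t by (simp add: field_simps)
      qed
      then show ?thesis using s False by (simp add: field_simps)
    qed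
  qed
  then show ?thesis using le neg by (auto simp: le_fun_def)
qed

theorem sublinear_ge_linear:
  fixes p :: "'a::real_vector \<Rightarrow> real"
  assumes p: "sublinear p"
  shows "\<exists>f. linear f \<and> (\<forall>x. f x \<le> p x)"
proof -
  define A where "A = {q. sublinear q \<and> q \<le> p}"
  \<comment> \<open>With the order reversed, the upper bounds that Zorn's lemma asks for are
    pointwise infima of chains, and its maximal elements are minimal functionals.\<close>
  have po: "partial_order_on A (relation_of (\<ge>) A)"
    by (intro partial_order_on_relation_ofI) auto
  have "\<exists>q\<in>A. \<forall>r\<in>A. q \<ge> r \<longrightarrow> r = q"
  proof (rule predicate_Zorn[OF po])
    fix C assume C: "C \<in> Chains (relation_of (\<ge>) A)"
    then have CA: "q \<in> A" if "q \<in> C" for q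
      using that unfolding Chains_def relation_of_def by auto
    have chain: "q \<le> r \<or> r \<le> q" if "q \<in> C" "r \<in> C" for q r
      using C that unfolding Chains_def relation_of_def by auto
    show "\<exists>u\<in>A. \<forall>a\<in>C. a \<ge> u"
    proof (cases "C = {}")
      case True
      then show ?thesis using p by (auto simp: A_def)
    next
      case False
      let ?u = "\<lambda>x. INF q\<in>C. q x"
      have CA': "sublinear q" "q x \<le> p x" if "q \<in> C" for q x
        using CA[OF that] by (auto simp: A_def le_fun_def)
      have u: "sublinear ?u" and low: "\<And>q x. q \<in> C \<Longrightarrow> ?u x \<le> q x"
        using sublinear_INF_chain[of C p] False CA' chain by auto
      obtain q where "q \<in> C" using False by blast
      then have "?u \<le> p" using low CA' by (meson le_funI order_trans)
      then have "?u \<in> A" using u by (simp add: A_def)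
      then show ?thesis using low by (metis (no_types, lifting) le_funI)
    qed
  qed
  then obtain q where q: "sublinear q" "q \<le> p" and min: "\<And>r. sublinear r \<Longrightarrow> r \<le> q \<Longrightarrow> r = q"
    unfolding A_def by (auto intro: order_trans)
  \<comment> \<open>By minimality \<open>sublinear_lower\<close> returns \<open>q\<close> itself, so
    \<open>q (- y) \<le> - q y\<close>; the other inequality is subadditivity.\<close>
  have neg: "q (- y) = - q y" for y
    using sublinear_lower[OF q(1), of y] min sublinear_ge[OF q(1), of "- y"] by force
  \<comment> \<open>Superadditivity comes from splitting \<open>x\<close> as
    \<open>(x + y) + (- y)\<close> and using oddness.\<close>
  have add: "q (x + y) = q x + q y" for x y
    using sublinear_add[OF q(1), of x y] sublinear_add[OF q(1), of "x + y" "- y"] neg[of y] by simp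
  have "q (t *\<^sub>R x) = t * q x" for t x
  proof (cases "t \<ge> 0")
    case False
    then have "q ((- t) *\<^sub>R x) = (- t) * q x"
      using sublinear_scaleR[OF q(1), of "- t" x] by linarith
    then show ?thesis using neg[of "t *\<^sub>R x"] by simp
  qed (simp add: sublinear_scaleR q)
  then have "linear q" using add by (intro linearI) auto
  then show ?thesis using q(2) by (auto simp: le_fun_def)
qed

section \<open>Bounded functionals separate points\<close>

text \<open>Lowering the norm to \<open>r\<close> with \<open>r (- x) \<le> - norm x\<close> takes
  the place of extending from the line through \<open>x\<close>: any linear \<open>f \<le> r\<close>
  satisfies \<open>f x = - f (- x) \<ge> norm x\<close>.\<close>

lemma norming_functional:
  fixes x :: "'a::real_normed_vector"
  shows "\<exists>f. bounded_linear f \<and> f x = norm x \<and> (\<forall>y. \<bar>f y\<bar> \<le> norm y)"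
proof -
  have "sublinear (norm :: 'a \<Rightarrow> real)"
    by (simp add: sublinear_def norm_triangle_ineq)
  then obtain r where r: "sublinear r" "r \<le> norm" "r (- x) \<le> - norm x"
    using sublinear_lower[of norm x] by blast
  obtain f where f: "linear f" "\<And>y. f y \<le> r y"
    using sublinear_ge_linear[OF r(1)] by blast
  have le: "f y \<le> norm y" for y
    using f(2)[of y] r(2) by (meson le_funD order_trans)
  have bound: "\<bar>f y\<bar> \<le> norm y" for y
    using le[of y] le[of "- y"] linear_neg[OF f(1), of y] by auto
  have "f x \<ge> norm x"
    using f(2)[of "- x"] r(3) linear_neg[OF f(1), of x] by simp
  moreover have "bounded_linear f"
    using f(1) bound by (intro bounded_linear_intro[of f 1]) (auto simp: linear_add linear_scale)
  ultimately show ?thesis using le[of x] bound by auto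
qed

lemma bounded_functional_separates:
  fixes x y :: "'a::cstar_algebra"
  assumes "\<And>\<phi>. bounded_functional \<phi> \<Longrightarrow> \<phi> x = \<phi> y"
  shows "x = y"
proof -
  obtain f where f: "bounded_linear f" "f (x - y) = norm (x - y)"
      and bound: "\<And>z::'a. \<bar>f z\<bar> \<le> norm z"
    using norming_functional by metis
  interpret f: bounded_linear f by (rule f)
  \<comment> \<open>The standard complexification \<open>f z - \<i> f (\<i> z)\<close> of a real
    functional: it is complex linear with real part \<open>f\<close>.\<close>
  define \<phi> where "\<phi> z = Complex (f z) (- f (\<i> *\<^sub>C z))" for z
  have scale: "c *\<^sub>C z = Re c *\<^sub>R z + Im c *\<^sub>R (\<i> *\<^sub>C z)" for c and z :: 'a
  proof -
    have "c = complex_of_real (Re c) + complex_of_real (Im c) * \<i>"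
      by (simp add: complex_eq_iff)
    then have "c *\<^sub>C z = (complex_of_real (Re c) + complex_of_real (Im c) * \<i>) *\<^sub>C z"
      by (rule arg_cong)
    then show ?thesis
      by (simp only: scaleC_add_left scaleC_scaleC[symmetric] scaleC_of_real)
  qed
  have i_i: "\<i> *\<^sub>C (\<i> *\<^sub>C z) = - z" for z :: 'a
    using scaleC_of_real[of "-1" z] by (simp add: scaleC_scaleC)
  have i_scaleR: "\<i> *\<^sub>C (t *\<^sub>R z) = t *\<^sub>R (\<i> *\<^sub>C z)" for t and z :: 'a
    by (simp add: scaleC_scaleC scaleC_of_real[symmetric] mult.commute)
  have lin: "\<phi> (c *\<^sub>C z) = c * \<phi> z" for c z
  proof -
    have "\<i> *\<^sub>C (c *\<^sub>C z) = Re c *\<^sub>R (\<i> *\<^sub>C z) - Im c *\<^sub>R z"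
      by (subst scale) (simp add: scaleC_add_right i_scaleR i_i)
    moreover have "f (c *\<^sub>C z) = Re c * f z + Im c * f (\<i> *\<^sub>C z)"
      by (subst scale) (simp add: f.add f.scaleR)
    ultimately show ?thesis
      by (simp add: \<phi>_def complex_eq_iff f.diff f.scaleR)
  qed
  have "bounded_linear \<phi>"
  \<comment> \<open>The constant 2 adds the bounds for the real and imaginary parts; multiplication
    by \<open>\<i>\<close> is isometric.\<close>
  proof (rule bounded_linear_intro[of \<phi> 2])
    show "\<phi> (z + w) = \<phi> z + \<phi> w" for z w
      by (simp add: \<phi>_def complex_eq_iff f.add scaleC_add_right)
    show "\<phi> (t *\<^sub>R z) = t *\<^sub>R \<phi> z" for t z
      by (simp add: \<phi>_def complex_eq_iff f.scaleR i_scaleR)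
    show "norm (\<phi> z) \<le> norm z * 2" for z
      using cmod_le[of "\<phi> z"] bound[of z] bound[of "\<i> *\<^sub>C z"] by (simp add: \<phi>_def norm_scaleC)
  qed
  then have "\<phi> x = \<phi> y"
    using assms lin by (simp add: bounded_functional_def)
  then have "f x = f y" by (simp add: \<phi>_def)
  then show ?thesis using f(2) by (simp add: f.diff)
qed

section \<open>Uniqueness and a.e. invariance of weak integrals\<close>

lemma has_weak_integral_unique:
  assumes "has_weak_integral M F x" and "has_weak_integral M F y"
  shows "x = y"
  using assms unfolding has_weak_integral_def
  by (blast intro: bounded_functional_separates has_bochner_integral_eq)

lemma weak_integral_eqI: "has_weak_integral M F x \<Longrightarrow> weak_integral M F = x"
  unfolding weak_integral_def by (blast intro: the_equality has_weak_integral_unique)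

text \<open>The preimages of a set under \<open>f\<close> and \<open>g\<close> differ by a null set,
  and completeness makes such a change harmless.\<close>

lemma (in complete_measure) measurable_AE_cong:
  assumes f: "f \<in> M \<rightarrow>\<^sub>M N" and AE: "AE x in M. f x = g x" and g: "g \<in> space M \<rightarrow> space N"
  shows "g \<in> M \<rightarrow>\<^sub>M N"
proof (rule measurableI)
  fix A assume A: "A \<in> sets N"
  show "g -` A \<inter> space M \<in> sets M"
  proof (rule in_sets_AE)
    show "AE x in M. x \<in> f -` A \<inter> space M \<longleftrightarrow> x \<in> g -` A \<inter> space M"
      using AE by eventually_elim auto
    show "f -` A \<inter> space M \<in> sets M" using f A by simp
  qed auto
qed (use g in auto)

text \<open>Measurability of each \<open>\<phi> (G m)\<close> is inherited from \<open>F\<close>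
  because the integrals are taken over \<open>completion M\<close>. This allows arbitrary changes of
  representatives.\<close>

lemma has_weak_integral_AE_cong:
  assumes F: "has_weak_integral M F x" and AE: "AE m in M. F m = G m"
  shows "has_weak_integral M G x"
  unfolding has_weak_integral_def
proof (intro allI impI)
  fix \<phi> :: "'b \<Rightarrow> complex" assume "bounded_functional \<phi>"
  then have int: "has_bochner_integral (completion M) (\<lambda>m. \<phi> (F m)) (\<phi> x)"
    using F by (simp add: has_weak_integral_def)
  have AE': "AE m in completion M. \<phi> (F m) = \<phi> (G m)"
    using AE by (intro AE_completion) auto
  have meas: "(\<lambda>m. \<phi> (F m)) \<in> borel_measurable (completion M)"
    using int by (rule borel_measurable_has_bochner_integral)
  have "(\<lambda>m. \<phi> (G m)) \<in> borel_measurable (completion M)"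
    by (rule completion.measurable_AE_cong[OF meas AE']) auto
  then show "has_bochner_integral (completion M) (\<lambda>m. \<phi> (G m)) (\<phi> x)"
    using int has_bochner_integral_cong_AE[OF meas _ AE'] by blast
qed

section \<open>Adjoints in Hilbert modules\<close>

context hilbert_module
begin

lemma ip_cancel_left:
  assumes x: "x \<in> carrier X" and y: "y \<in> carrier X"
    and eq: "\<And>z. z \<in> carrier X \<Longrightarrow> ip X x z = ip X y z"
  shows "x = y"
proof -
  let ?d = "x \<ominus> y"
  have d: "?d \<in> carrier X" using x y by simp
  have x_eq: "?d \<oplus> y = x" using x y by (simp add: minus_eq a_assoc l_neg)
  \<comment> \<open>Testing on the difference \<open>?d\<close> itself; writing \<open>x\<close> as
    \<open>?d \<oplus> y\<close> reduces the computation to additivity of \<open>ip\<close>.\<close>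
  have "ip X x ?d = ip X ?d ?d + ip X y ?d"
    using ip_add[OF d y d] x_eq by simp
  then have "?d = \<zero>" using eq[OF d] ip_definite[OF d] by simp
  then show ?thesis using x_eq y by simp
qed

lemma ip_cancel_right:
  assumes x: "x \<in> carrier X" and y: "y \<in> carrier X"
    and eq: "\<And>z. z \<in> carrier X \<Longrightarrow> ip X z x = ip X z y"
  shows "x = y"
  using x y eq ip_star by (metis ip_cancel_left)

text \<open>Vectors are determined by their inner products, so the definite description in
  \<open>hadj\<close> is settled by exhibiting one vector with the adjoint identity at the given
  \<open>y\<close>.\<close>

lemma hadj_eqI:
  assumes "x \<in> carrier X" and "\<And>z. z \<in> carrier X \<Longrightarrow> ip Y (T z) y = ip X z x"
  shows "hadj X Y T y = x"
  unfolding hadj_def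
proof (rule the_equality)
  fix x' assume x': "x' \<in> carrier X \<and> (\<forall>z\<in>carrier X. ip Y (T z) y = ip X z x')"
  then show "x' = x" using assms by (intro ip_cancel_right) auto
qed (use assms in auto)

lemma hadj_adjoint:
  assumes "T \<in> End_star X Y" and "y \<in> carrier Y"
  shows "hadj X Y T y \<in> carrier X"
    and "\<And>z. z \<in> carrier X \<Longrightarrow> ip X z (hadj X Y T y) = ip Y (T z) y"
proof -
  obtain S where S: "S \<in> carrier Y \<rightarrow> carrier X"
      "\<forall>x\<in>carrier X. \<forall>y\<in>carrier Y. ip Y (T x) y = ip X x (S y)"
    using assms(1) unfolding End_star_def by blast
  have "S y \<in> carrier X" using S assms by auto
  then have "hadj X Y T y = S y"
    by (rule hadj_eqI) (use S assms in blast)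
  then show "hadj X Y T y \<in> carrier X"
    and "\<And>z. z \<in> carrier X \<Longrightarrow> ip X z (hadj X Y T y) = ip Y (T z) y"
    using S assms by auto
qed

end

text \<open>\<open>hadj\<close> is characterised in the second argument of \<open>ip\<close>; taking
  \<open>star\<close> twice moves it to the first. The restricted module keeps the inner product of
  \<open>V\<close>.\<close>

lemma ip_hadj:
  assumes U: "hilbert_module U" and V: "hilbert_module V" and W: "W \<subseteq> carrier V"
    and T: "T \<in> End_star U (V \<restriction> W)" and v: "v \<in> W" and f: "f \<in> carrier U"
  shows "ip U (hadj U (V \<restriction> W) T v) f = ip V v (T f)"
proof -
  have "T f \<in> W" using T f by (auto simp: End_star_def)
  then have "ip V v (T f) = star (ip V (T f) v)"
    using hilbert_module.ip_star[OF V subsetD[OF W] subsetD[OF W v]] by metis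
  also have "ip V (T f) v = ip U f (hadj U (V \<restriction> W) T v)"
    using hilbert_module.hadj_adjoint(2)[OF U T, of v f] v f by simp
  also have "star \<dots> = ip U (hadj U (V \<restriction> W) T v) f"
    using hilbert_module.ip_star[OF U f] hilbert_module.hadj_adjoint(1)[OF U T, of v] v by simp
  finally show ?thesis ..
qed

section \<open>The direct sum and the analysis map\<close>

lemma some_rep_family_class:
  assumes "g \<in> sum_families M V W"
  shows "AE m in M. some_rep (family_class M V W g) m = g m"
proof -
  have "g \<in> family_class M V W g" using assms by (simp add: family_class_def)
  then have "some_rep (family_class M V W g) \<in> family_class M V W g" by (rule someI[of "\<lambda>h. h \<in> _"])
  then show ?thesis by (simp add: family_class_def)
qed

text \<open>The chosen representatives agree a.e. with \<open>g\<close> and \<open>h\<close>, so the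
  inner product of two classes may be computed on any representatives.\<close>

lemma ip_direct_sum:
  assumes g: "g \<in> sum_families M V W" and h: "h \<in> sum_families M V W"
    and int: "has_weak_integral M (\<lambda>m. ip V (g m) (h m)) x"
  shows "ip (direct_sum M V W) (family_class M V W g) (family_class M V W h) = x"
proof -
  have "AE m in M. ip V (g m) (h m)
      = ip V (some_rep (family_class M V W g) m) (some_rep (family_class M V W h) m)"
    using some_rep_family_class[OF g] some_rep_family_class[OF h] by eventually_elim simp
  then show ?thesis
    using has_weak_integral_AE_cong[OF int] by (simp add: direct_sum_def weak_integral_eqI)
qed

lemma cg_bessel_sum_families:
  assumes "cg_bessel M U V W \<Gamma>" and "f \<in> carrier U"
  shows "(\<lambda>m. \<Gamma> m f) \<in> sum_families M V W"
  using assms unfolding cg_bessel_def cg_family_def sum_families_def End_star_def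
  by fastforce

text \<open>For \<open>z\<close> the class of \<open>g\<close>, \<open>ip U (R z) f\<close> is the
  weak integral of \<open>ip V (g m) (\<Gamma> m f)\<close>, which is the inner product of
  \<open>z\<close> with the class of \<open>m \<mapsto> \<Gamma> m f\<close>.\<close>

lemma hadj_synthesis_operator:
  assumes U: "hilbert_module U" and V: "hilbert_module V"
    and W: "\<forall>m\<in>space M. closed_submodule V (W m)"
    and D: "hilbert_module (direct_sum M V W)"
    and \<Gamma>: "cg_bessel M U V W \<Gamma>"
    and R: "synthesis_operator M U V W \<Gamma> R"
    and f: "f \<in> carrier U"
  shows "hadj (direct_sum M V W) U R f = family_class M V W (\<lambda>m. \<Gamma> m f)"
proof (rule hilbert_module.hadj_eqI[OF D])
  have \<Gamma>f: "(\<lambda>m. \<Gamma> m f) \<in> sum_families M V W"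
    by (rule cg_bessel_sum_families[OF \<Gamma> f])
  then show "family_class M V W (\<lambda>m. \<Gamma> m f) \<in> carrier (direct_sum M V W)"
    by (simp add: direct_sum_def)
  fix z assume "z \<in> carrier (direct_sum M V W)"
  then obtain g where g: "g \<in> sum_families M V W" and z: "z = family_class M V W g"
    by (auto simp: direct_sum_def)
  have "has_weak_integral M (\<lambda>m. ip U (hadj U (V \<restriction> W m) (\<Gamma> m) (g m)) f) (ip U (R z) f)"
    using R g f z by (simp add: synthesis_operator_def)
  moreover have "ip U (hadj U (V \<restriction> W m) (\<Gamma> m) (g m)) f = ip V (g m) (\<Gamma> m f)"
    if "m \<in> space M" for m
  proof (rule ip_hadj[OF U V _ _ _ f])
    show "W m \<subseteq> carrier V" using W that by (simp add: closed_submodule_def)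
    show "\<Gamma> m \<in> End_star U (V \<restriction> W m)" using \<Gamma> that by (simp add: cg_bessel_def cg_family_def)
    show "g m \<in> W m" using g that by (simp add: sum_families_def)
  qed
  ultimately have "has_weak_integral M (\<lambda>m. ip V (g m) (\<Gamma> m f)) (ip U (R z) f)"
    by (elim has_weak_integral_AE_cong) auto
  then show "ip U (R z) f = ip (direct_sum M V W) z (family_class M V W (\<lambda>m. \<Gamma> m f))"
    using ip_direct_sum[OF g \<Gamma>f] z by simp
qed

theorem theorem3p5:
  fixes M :: "'m measure"
    and U :: "('a::cstar_algebra, 'u) hmodule"
    and V :: "('a, 'v) hmodule"
    and W :: "'m \<Rightarrow> 'v set"
    and K :: "'u \<Rightarrow> 'u"
    and \<Theta> \<Lambda> \<Gamma> :: "'m \<Rightarrow> 'u \<Rightarrow> 'v"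
    and T R :: "('m \<Rightarrow> 'v) set \<Rightarrow> 'u"
  assumes "hilbert_module U" and "hilbert_module V"
    and "\<forall>m\<in>space M. closed_submodule V (W m)"
    and "hilbert_module (direct_sum M V W)"
    and "K \<in> End_star U U"
    and "cg_orthonormal_basis M U V W \<Theta>"
    and "cKg_frame M U V W K \<Lambda>"
    and "cg_bessel M U V W \<Gamma>"
    and "synthesis_operator M U V W \<Lambda> T"
    and "synthesis_operator M U V W \<Gamma> R"
  shows "dual_cKg_bessel M U V W K \<Lambda> \<Gamma> \<longleftrightarrow>
    (\<forall>f\<in>carrier U. K f = T (hadj (direct_sum M V W) U R f))"
proof -
  let ?D = "direct_sum M V W"
  have K: "K f \<in> carrier U" if "f \<in> carrier U" for f
    using \<open>K \<in> End_star U U\<close> that by (auto simp: End_star_def)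
  \<comment> \<open>Since \<open>R\<^sup>* f\<close> is the class of
    \<open>m \<mapsto> \<Gamma> m f\<close>, the defining property of \<open>T\<close> at this class
    is exactly the integral in the duality condition.\<close>
  have TR: "T (hadj ?D U R f) \<in> carrier U"
    and int: "\<And>g. g \<in> carrier U \<Longrightarrow>
      has_weak_integral M (\<lambda>m. ip U (hadj U (V \<restriction> W m) (\<Lambda> m) (\<Gamma> m f)) g)
        (ip U (T (hadj ?D U R f)) g)" if f: "f \<in> carrier U" for f
  proof -
    have \<Gamma>f: "(\<lambda>m. \<Gamma> m f) \<in> sum_families M V W"
      by (rule cg_bessel_sum_families[OF assms(8) f])
    have R: "hadj ?D U R f = family_class M V W (\<lambda>m. \<Gamma> m f)"
      by (rule hadj_synthesis_operator[OF assms(1-4,8,10) f])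
    have "hadj ?D U R f \<in> carrier ?D" using \<Gamma>f R by (simp add: direct_sum_def)
    then show "T (hadj ?D U R f) \<in> carrier U"
      using assms(9) by (auto simp: synthesis_operator_def End_star_def)
    show "has_weak_integral M (\<lambda>m. ip U (hadj U (V \<restriction> W m) (\<Lambda> m) (\<Gamma> m f)) g)
        (ip U (T (hadj ?D U R f)) g)" if "g \<in> carrier U" for g
      using bspec[OF bspec[OF conjunct2[OF assms(9)[unfolded synthesis_operator_def]] \<Gamma>f] that]
      unfolding R .
  qed
  show ?thesis
  proof
    assume dual: "dual_cKg_bessel M U V W K \<Lambda> \<Gamma>"
    show "\<forall>f\<in>carrier U. K f = T (hadj ?D U R f)"
    proof
      fix f assume f: "f \<in> carrier U"
      show "K f = T (hadj ?D U R f)"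
      \<comment> \<open>For each \<open>g\<close>, both inner products are weak integrals of the
        same function, hence equal.\<close>
      proof (rule hilbert_module.ip_cancel_left[OF assms(1) K[OF f] TR[OF f]])
        fix g assume "g \<in> carrier U"
        then show "ip U (K f) g = ip U (T (hadj ?D U R f)) g"
          using dual int[OF f] f by (auto simp: dual_cKg_bessel_def intro: has_weak_integral_unique)
      qed
    qed
  next
    assume "\<forall>f\<in>carrier U. K f = T (hadj ?D U R f)"
    then show "dual_cKg_bessel M U V W K \<Lambda> \<Gamma>"
      using int assms(8) by (simp add: dual_cKg_bessel_def)
  qed
qed

end
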